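(* Let $K$ be a field of characteristic $\neq2$, let $f\in K[t]$ be a polynomial of degree $2g+2$ with no multiple roots, and let $f=f^{(1)}f^{(2)}$ be a factorization into two polynomials in $K[t]$ of degree $g+1$. Let $a,b,c,d\in K[t]$, not all zero, and let $k=\max\{\deg a,\ g+1+\deg b,\ \deg c,\ g+1+\deg d\}$. Then the two functions $a+b\sqrt f$ and $c+d\sqrt f$ have a common zero if and only if the determinant of the $4k\times4k$ matrix $$\begin{pmatrix}\mathrm{syl}(k,a)&\mathrm{syl}(k,bf^{(2)})&\mathrm{syl}(k,c)&\mathrm{syl}(k,df^{(2)})\\ \mathrm{syl}(k,bf^{(1)})&\mathrm{syl}(k,a)&\mathrm{syl}(k,df^{(1)})&\mathrm{syl}(k,c)\end{pmatrix}$$ vanishes.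
   Context: For a polynomial $r=r_0+r_1t+\dots+r_kt^k$ of degree at most $k$, $\mathrm{syl}(k,r)$ is the $2k\times k$ "Sylvester block", the transpose of the $k\times2k$ matrix $$\begin{pmatrix} r_0&r_1&\cdots&r_k&0&\cdots&0\\0&r_0&\cdots&r_{k-1}&r_k&\cdots&0\\ \vdots&\ddots&\ddots&&\ddots&\ddots&\vdots\\0&\cdots&0&r_0&\cdots&r_{k-1}&r_k\end{pmatrix},$$ i.e. the matrix of multiplication by $r$ from polynomials of degree $<k$ to polynomials of degree $<2k$ in the monomial bases. The degree of the zero polynomial is $-\infty$. Let $C$ be the smooth projective (hyperelliptic) curve with function field $K(t)[\sqrt f]$ and $\pi:C\to\mathbf P^1$ the double cover given by $K(t)\subset K(t)[\sqrt f]$. The functions $1,t,\dots,t^k,\sqrt f,t\sqrt f,\dots,t^{k-g-1}\sqrt f$ are regarded as global sections of the line bundle $\mathcal O_C(H)=\pi^*\mathcal O_{\mathbf P^1}(k)$; "common zero" means a common zero of $a+b\sqrt f$ and $c+d\sqrt f$, regarded as sections of $\mathcal O_C(H)$, at a point of $C$ over an algebraic closure of $K$ (points over $t=\infty$ included). *)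

theory Defs
  imports
    "HOL-Algebra.Algebraic_Closure_Type"
    "HOL-Library.Extended_Real"
    "Jordan_Normal_Form.Determinant"
begin

definition ext_degree :: "'a::zero poly \<Rightarrow> ereal"
  where "ext_degree p = (if p = 0 then - \<infinity> else ereal (real (Polynomial.degree p)))"

definition syl :: "nat \<Rightarrow> 'a::zero poly \<Rightarrow> 'a mat"
  where "syl k r = transpose_mat
    (mat k (2 * k) (\<lambda>(i, j). if i \<le> j \<and> j \<le> i + k then poly.coeff r (j - i) else 0))"

definition append_cols :: "'a::zero mat \<Rightarrow> 'a mat \<Rightarrow> 'a mat"  (infixr \<open>@\<^sub>c\<close> 66)
  where "A @\<^sub>c B = four_block_mat A B (0\<^sub>m 0 (dim_col A)) (0\<^sub>m 0 (dim_col B))"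

definition resultant_mat ::
  "nat \<Rightarrow> 'a::comm_semiring_0 poly \<Rightarrow> 'a poly \<Rightarrow> 'a poly \<Rightarrow> 'a poly \<Rightarrow> 'a poly \<Rightarrow> 'a poly \<Rightarrow> 'a mat"
  where "resultant_mat k f1 f2 a b c d =
    (syl k a @\<^sub>c syl k (b * f2) @\<^sub>c syl k c @\<^sub>c syl k (d * f2)) @\<^sub>r
    (syl k (b * f1) @\<^sub>c syl k a @\<^sub>c syl k (d * f1) @\<^sub>c syl k c)"

lemma syl_carrier [simp, intro]: "syl k r \<in> carrier_mat (2 * k) k"
  by (simp add: syl_def)

lemma append_cols_carrier [simp, intro]:
  assumes "A \<in> carrier_mat n m1" "B \<in> carrier_mat n m2"
  shows "A @\<^sub>c B \<in> carrier_mat n (m1 + m2)"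
  using assms by (auto simp: append_cols_def)

lemma resultant_mat_carrier: "resultant_mat k f1 f2 a b c d \<in> carrier_mat (4 * k) (4 * k)"
proof -
  have row: "syl k p @\<^sub>c syl k q @\<^sub>c syl k r @\<^sub>c syl k s \<in> carrier_mat (2 * k) (k + (k + (k + k)))"
    for p q r s :: "'a poly"
    by (intro append_cols_carrier syl_carrier)
  have "resultant_mat k f1 f2 a b c d \<in> carrier_mat (2 * k + 2 * k) (k + (k + (k + k)))"
    unfolding resultant_mat_def by (intro carrier_append_rows row)
  moreover have "2 * k + 2 * k = 4 * k" "k + (k + (k + k)) = 4 * k" by simp_all
  ultimately show ?thesis by metis
qed

text \<open>
  \<open>hom_eval n p x z\<close> is the value at \<open>(x, z)\<close> of the binary form \<open>z^n p(x/z)\<close> of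
  degree \<open>n\<close>, for \<open>p\<close> of degree at most \<open>n\<close>.
\<close>

definition hom_eval :: "nat \<Rightarrow> 'a::comm_semiring_1 poly \<Rightarrow> 'a \<Rightarrow> 'a \<Rightarrow> 'a"
  where "hom_eval n p x z = (\<Sum>i\<le>n. poly.coeff p i * x ^ i * z ^ (n - i))"

text \<open>
  The curve is taken over a field \<open>L\<close>, in the statement an algebraic closure of the base field, so
  that only \<open>L\<close>-points occur. For \<open>f\<close> of degree \<open>2 g + 2\<close> without multiple
  roots and characteristic different from 2, the smooth projective model of \<open>L(t)[\<surd>f]\<close> is the
  curve \<open>y^2 = z^(2 g + 2) f(x/z)\<close> in the weighted projective plane with coordinates
  \<open>x, z, y\<close> of weights \<open>1, 1, g + 1\<close>; the double cover of the projective line is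
  \<open>t = x/z\<close>, and \<open>\<surd>f = y/z^(g + 1)\<close>. Equivalently, it is glued from the two affine
  curves \<open>y^2 = f(t)\<close> (where \<open>z = 1\<close>) and \<open>w^2 = s^(2 g + 2) f(1/s)\<close>
  (where \<open>x = 1\<close>) along \<open>s = 1/t\<close>, \<open>w = y/t^(g + 1)\<close>. A point is an
  equivalence class of coordinate triples.
\<close>

definition curve_coords :: "nat \<Rightarrow> 'a::field poly \<Rightarrow> ('a \<times> 'a \<times> 'a) set"
  where "curve_coords g f = {(x, z, y). (x, z) \<noteq> (0, 0) \<and> y\<^sup>2 = hom_eval (2 * g + 2) f x z}"

definition weighted_rel :: "nat \<Rightarrow> (('a::field \<times> 'a \<times> 'a) \<times> ('a \<times> 'a \<times> 'a)) set"
  where "weighted_rel g =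
    {((x, z, y), (x', z', y')). \<exists>l. l \<noteq> 0 \<and> x' = l * x \<and> z' = l * z \<and> y' = l ^ (g + 1) * y}"

definition hyperelliptic_curve :: "nat \<Rightarrow> 'a::field poly \<Rightarrow> ('a \<times> 'a \<times> 'a) set set"
  where "hyperelliptic_curve g f = curve_coords g f // weighted_rel g"

text \<open>
  Sections of the pullback of \<open>O(k)\<close> are the forms of weighted degree \<open>k\<close>. The function
  \<open>a + b \<surd>f\<close>, with \<open>deg a \<le> k\<close> and \<open>g + 1 + deg b \<le> k\<close>, is the section
  \<open>z^k (a(x/z) + b(x/z) y/z^(g + 1))\<close>. If \<open>k < g + 1\<close> then \<open>b = 0\<close>, so the truncated
  subtraction is harmless.
\<close>

definition section_value ::
  "nat \<Rightarrow> nat \<Rightarrow> 'a::field poly \<Rightarrow> 'a poly \<Rightarrow> 'a \<times> 'a \<times> 'a \<Rightarrow> 'a"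
  where "section_value g k a b =
    (\<lambda>(x, z, y). hom_eval k a x z + hom_eval (k - (g + 1)) b x z * y)"

definition section_zero_at ::
  "nat \<Rightarrow> nat \<Rightarrow> 'a::field poly \<Rightarrow> 'a poly \<Rightarrow> ('a \<times> 'a \<times> 'a) set \<Rightarrow> bool"
  where "section_zero_at g k a b P \<longleftrightarrow> (\<forall>v\<in>P. section_value g k a b v = 0)"

definition have_common_zero ::
  "nat \<Rightarrow> 'a::field poly \<Rightarrow> nat \<Rightarrow> 'a poly \<Rightarrow> 'a poly \<Rightarrow> 'a poly \<Rightarrow> 'a poly \<Rightarrow> bool"
  where "have_common_zero g f k a b c d \<longleftrightarrow>
    (\<exists>P \<in> hyperelliptic_curve g (map_poly to_ac f).
       section_zero_at g k (map_poly to_ac a) (map_poly to_ac b) P \<and>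
       section_zero_at g k (map_poly to_ac c) (map_poly to_ac d) P)"

lemma hom_eval_0 [simp]: "hom_eval n 0 x z = 0"
  by (simp add: hom_eval_def)

lemma hom_eval_scale: "hom_eval n p (l * x) (l * z) = l ^ n * hom_eval n p x z"
proof -
  have "p' * (l * x) ^ i * (l * z) ^ (n - i) = l ^ n * (p' * x ^ i * z ^ (n - i))" if "i \<le> n" for i p'
  proof -
    have "l ^ n = l ^ i * l ^ (n - i)" using that by (metis le_add_diff_inverse power_add)
    thus ?thesis by (simp only: power_mult_distrib mult_ac)
  qed
  thus ?thesis by (simp add: hom_eval_def sum_distrib_left)
qed

lemma hom_eval_affine:
  assumes "Polynomial.degree p \<le> n"
  shows "hom_eval n p t 1 = poly p t"
  unfolding hom_eval_def poly_altdef using assms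
  by (intro sum.mono_neutral_cong_right) (auto simp: coeff_eq_0)

lemma hom_eval_infinity: "hom_eval n p 1 0 = poly.coeff p n"
proof -
  have "hom_eval n p 1 0 = (\<Sum>i\<le>n. if i = n then poly.coeff p i else 0)"
    unfolding hom_eval_def by (intro sum.cong) (auto simp: power_0_left)
  thus ?thesis by simp
qed

lemma equiv_weighted_rel:
  "equiv UNIV (weighted_rel g :: (('a::field \<times> 'a \<times> 'a) \<times> ('a \<times> 'a \<times> 'a)) set)"
  (is "equiv UNIV ?R")
proof (rule equivI)
  show "refl ?R"
    by (auto simp: refl_on_def weighted_rel_def intro!: exI[of _ 1])
  show "sym ?R"
  proof (rule symI)
    fix u v :: "'a \<times> 'a \<times> 'a"
    assume "(u, v) \<in> weighted_rel g"
    then obtain x z y l where "u = (x, z, y)" "v = (l * x, l * z, l ^ (g + 1) * y)" "l \<noteq> 0"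
      by (auto simp: weighted_rel_def)
    thus "(v, u) \<in> weighted_rel g"
      by (auto simp: weighted_rel_def field_simps intro!: exI[of _ "inverse l"])
  qed
  show "trans ?R"
  proof (rule transI)
    fix u v w :: "'a \<times> 'a \<times> 'a"
    assume "(u, v) \<in> weighted_rel g" "(v, w) \<in> weighted_rel g"
    then obtain x z y l m where "u = (x, z, y)" "l \<noteq> 0" "m \<noteq> 0"
        "w = (m * (l * x), m * (l * z), m ^ (g + 1) * (l ^ (g + 1) * y))"
      by (auto simp: weighted_rel_def)
    thus "(u, w) \<in> weighted_rel g"
      by (auto simp: weighted_rel_def power_mult_distrib intro!: exI[of _ "m * l"])
  qed
qed simp

lemma curve_coords_weighted_rel:
  assumes "u \<in> curve_coords g f" "(u, v) \<in> weighted_rel g"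
  shows "v \<in> curve_coords g f"
proof -
  obtain x z y l where *: "u = (x, z, y)" "v = (l * x, l * z, l ^ (g + 1) * y)" "l \<noteq> 0"
    using assms by (auto simp: weighted_rel_def)
  have "(g + 1) * 2 = 2 * g + 2" by simp
  hence "(l ^ (g + 1) * y)\<^sup>2 = l ^ (2 * g + 2) * y\<^sup>2"
    by (simp only: power_mult_distrib flip: power_mult)
  thus ?thesis using assms(1) * by (auto simp: curve_coords_def hom_eval_scale)
qed

lemma section_zero_at_class:
  assumes "b = 0 \<or> g + 1 \<le> k"
  shows "section_zero_at g k a b (weighted_rel g `` {u}) \<longleftrightarrow> section_value g k a b u = 0"
proof -
  obtain x z y where u: "u = (x, z, y)" by (cases u)
  have scale: "section_value g k a b (l * x, l * z, l ^ (g + 1) * y) = l ^ k * section_value g k a b u" for l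
  proof (cases "b = 0")
    case True
    thus ?thesis by (simp add: section_value_def u hom_eval_scale)
  next
    case False
    hence "l ^ k = l ^ (k - (g + 1)) * l ^ (g + 1)" using assms by (metis le_add_diff_inverse2 power_add)
    thus ?thesis by (simp add: section_value_def u hom_eval_scale algebra_simps)
  qed
  have "(u, u) \<in> weighted_rel g"
    by (rule equiv_class_self[OF equiv_weighted_rel, unfolded Image_singleton_iff]) simp
  moreover have "section_value g k a b v = 0"
    if v: "(u, v) \<in> weighted_rel g" and 0: "section_value g k a b u = 0" for v
  proof -
    obtain l where "v = (l * x, l * z, l ^ (g + 1) * y)"
      using v by (auto simp: weighted_rel_def u)
    thus ?thesis using scale[of l] 0 by simp
  qed
  ultimately show ?thesis unfolding section_zero_at_def by blast
qed

lemma section_value_affine: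
  assumes "Polynomial.degree a \<le> k" "b = 0 \<or> g + 1 + Polynomial.degree b \<le> k"
  shows "section_value g k a b (t, 1, y) = poly a t + poly b t * y"
  using assms by (auto simp: section_value_def hom_eval_affine)

lemma section_value_infinity:
  "section_value g k a b (1, 0, w) = poly.coeff a k + poly.coeff b (k - (g + 1)) * w"
  by (simp add: section_value_def hom_eval_infinity)

text \<open>Jacobian criterion on the chart \<open>z = 1\<close> and at the points with \<open>z = 0\<close>.\<close>

lemma curve_smooth_affine:
  fixes f :: "'a::field poly"
  assumes "rsquarefree f" "Polynomial.degree f = 2 * g + 2" "(2::'a) \<noteq> 0"
    and "(t, 1, y) \<in> curve_coords g f"
  shows "2 * y \<noteq> 0 \<or> poly (pderiv f) t \<noteq> 0"
proof (rule ccontr)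
  assume "\<not> ?thesis"
  hence y: "y = 0" and d: "poly (pderiv f) t = 0" using assms(3) by auto
  have "poly f t = 0" using assms(2,4) y by (simp add: curve_coords_def hom_eval_affine)
  then obtain q where q: "f = [:-t, 1:] * q" by (auto simp: poly_eq_0_iff_dvd)
  have "poly q t = 0" using d unfolding q pderiv_mult by (simp add: pderiv_pCons)
  then obtain r where "q = [:-t, 1:] * r" by (auto simp: poly_eq_0_iff_dvd)
  hence "f = [:-t, 1:] ^ 2 * r" by (simp only: q power2_eq_square mult.assoc)
  hence "[:-t, 1:] ^ 2 dvd f" by (rule dvdI)
  moreover have "f \<noteq> 0" using assms(1) by (simp add: rsquarefree_def)
  ultimately have "2 \<le> Polynomial.order t f" by (simp add: order_divides)
  moreover have "Polynomial.order t f \<le> 1"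
    using assms(1) unfolding rsquarefree_def by (metis le_numeral_extra(4) zero_le_one)
  ultimately show False by simp
qed

lemma curve_smooth_infinity:
  fixes f :: "'a::field poly"
  assumes "Polynomial.degree f = 2 * g + 2" "(2::'a) \<noteq> 0"
    and "(1, 0, w) \<in> curve_coords g f"
  shows "2 * w \<noteq> 0"
proof -
  have "f \<noteq> 0" using assms(1) by auto
  hence "poly.coeff f (2 * g + 2) \<noteq> 0" using assms(1) by (metis leading_coeff_0_iff)
  thus ?thesis using assms(2,3) by (auto simp: curve_coords_def hom_eval_infinity)
qed

end

theory Submission
  imports Defs
begin

text \<open>
  Put \<open>s = a + b \<surd>f\<close> and \<open>s' = c + d \<surd>f\<close>. Writing elements of the rank two module
  \<open>M = K[t] + K[t] \<surd>f/f1\<close> as pairs, \<open>s\<close> acts by the matrix with rows \<open>(a, b f2)\<close> and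
  \<open>(b f1, a)\<close>, so the determinant vanishes iff there are nonzero \<open>(P, Q)\<close> in \<open>M\<close>, all of
  whose coordinates have degree \<open>< k\<close>, with \<open>s P + s' Q = 0\<close>.

  If \<open>s\<close> and \<open>s'\<close> vanish at a point over \<open>(x : z)\<close>, then a left eigenvector of
  \<open>\<surd>f\<close> on the fibre of \<open>M\<close> there, composed with evaluation of forms of degree
  \<open>2 k - 1\<close>, is a nonzero functional killing all columns; the eigenvector is nonzero because
  \<open>f1\<close> and \<open>f2\<close> have no common zero.

  Conversely, without a common affine zero the polynomials \<open>a^2 - b^2 f\<close>, \<open>c^2 - d^2 f\<close>,
  \<open>a d - b c\<close>, which lie in the ideal \<open>(s, s')\<close>, generate the unit ideal. Then the Koszul
  complex is exact: \<open>P = s' W\<close> and \<open>Q = - s W\<close> for some \<open>W\<close> in \<open>M\<close>. If \<open>W\<close> were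
  nonzero, the degree bounds would make the leading coefficient vector of \<open>W\<close> a common kernel
  vector of \<open>s\<close> and \<open>s'\<close> at infinity, giving a common zero there.
\<close>

section \<open>Binary forms\<close>

text \<open>\<open>n\<close> and \<open>m\<close> only bound the degrees: at infinity a section is
  represented by its coefficient in a fixed degree, which may be zero.\<close>

lemma coeff_mult_degree_bounds:
  fixes p q :: "'a::comm_semiring_0 poly"
  assumes "Polynomial.degree p \<le> n" "Polynomial.degree q \<le> m"
  shows "poly.coeff (p * q) (n + m) = poly.coeff p n * poly.coeff q m"
proof -
  have "poly.coeff (p * q) (n + m) = (\<Sum>i\<le>n + m. poly.coeff p i * poly.coeff q (n + m - i))"
    by (simp add: coeff_mult)
  also have "\<dots> = (\<Sum>i\<in>{n}. poly.coeff p i * poly.coeff q (n + m - i))"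
  proof (rule sum.mono_neutral_right)
    show "\<forall>i\<in>{..n + m} - {n}. poly.coeff p i * poly.coeff q (n + m - i) = 0"
    proof
      fix i assume "i \<in> {..n + m} - {n}"
      then have "i > n \<or> n + m - i > m" by auto
      then show "poly.coeff p i * poly.coeff q (n + m - i) = 0"
        using assms by (metis coeff_eq_0 le_less_trans mult_zero_left mult_zero_right)
    qed
  qed auto
  finally show ?thesis by simp
qed

lemma hom_eval_dehomogenize:
  fixes p :: "'a::field poly"
  assumes "Polynomial.degree p \<le> n" "z \<noteq> 0"
  shows "hom_eval n p x z = z ^ n * poly p (x / z)"
  using hom_eval_scale[of n p z "x / z" 1] hom_eval_affine[OF assms(1), of "x / z"] assms(2) by simp

lemma hom_eval_at_infinity: "hom_eval n p x 0 = x ^ n * poly.coeff p n"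
  using hom_eval_scale[of n p x 1 0] by (simp add: hom_eval_infinity)

lemma hom_eval_mult:
  fixes p q :: "'a::field poly"
  assumes "Polynomial.degree p \<le> n" "Polynomial.degree q \<le> m"
  shows "hom_eval (n + m) (p * q) x z = hom_eval n p x z * hom_eval m q x z"
proof (cases "z = 0")
  case True
  then show ?thesis
    using assms by (simp add: hom_eval_at_infinity coeff_mult_degree_bounds power_add)
next
  case False
  have "Polynomial.degree (p * q) \<le> n + m"
    using degree_mult_le[of p q] assms by linarith
  then show ?thesis
    using assms False by (simp add: hom_eval_dehomogenize power_add)
qed

text \<open>\<open>b\<close> is read as a form of degree \<open>k - m\<close>; the case
  \<open>b = 0\<close> covers \<open>k < m\<close>, where the subtraction truncates.\<close>

lemma hom_eval_mult_shift:
  fixes b e :: "'a::field poly"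
  assumes "b = 0 \<or> m + Polynomial.degree b \<le> k" "Polynomial.degree e \<le> m"
  shows "hom_eval k (b * e) x z = hom_eval (k - m) b x z * hom_eval m e x z"
proof (cases "b = 0")
  case False
  then show ?thesis
    using hom_eval_mult[of b "k - m" e m x z] assms by simp
qed simp

text \<open>A common zero at a finite point would be a double root of the product; at infinity the
  form of \<open>f1\<close> is a nonzero multiple of its leading coefficient.\<close>

lemma no_common_zero_of_factors:
  fixes f1 f2 :: "'a::field poly"
  assumes sqf: "rsquarefree (f1 * f2)"
    and deg: "Polynomial.degree f1 = m" "Polynomial.degree f2 = n"
    and xz: "(x, z) \<noteq> (0, 0)"
  shows "hom_eval m f1 x z \<noteq> 0 \<or> hom_eval n f2 x z \<noteq> 0"
proof (cases "z = 0")
  case True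
  have "f1 \<noteq> 0" using sqf by (auto simp: rsquarefree_def)
  then have "poly.coeff f1 m \<noteq> 0" using deg by auto
  then show ?thesis using True xz by (simp add: hom_eval_at_infinity)
next
  case False
  have "\<not> (poly f1 t = 0 \<and> poly f2 t = 0)" for t
  proof
    assume "poly f1 t = 0 \<and> poly f2 t = 0"
    moreover have nz: "f1 * f2 \<noteq> 0" using sqf by (auto simp: rsquarefree_def)
    ultimately have "Polynomial.order t f1 \<ge> 1" "Polynomial.order t f2 \<ge> 1"
      by (auto simp: order_root Suc_le_eq)
    then have "Polynomial.order t (f1 * f2) \<ge> 2" using order_mult[OF nz] by simp
    then show False using sqf unfolding rsquarefree_def
      by (metis One_nat_def Suc_1 not_less_eq_eq numeral_2_eq_2 order_refl zero_le)
  qed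
  then show ?thesis using False deg by (simp add: hom_eval_dehomogenize)
qed

section \<open>Entries of the matrix\<close>

lemma dim_syl [simp]: "dim_row (syl k r) = 2 * k" "dim_col (syl k r) = k"
  by (simp_all add: syl_def)

lemma syl_index:
  fixes r :: "'a::comm_semiring_1 poly"
  assumes "Polynomial.degree r \<le> k" "i < 2 * k" "j < k"
  shows "syl k r $$ (i, j) = poly.coeff (Polynomial.monom 1 j * r) i"
  using assms by (auto simp: syl_def coeff_monom_mult coeff_eq_0)

lemma dim_append_cols [simp]:
  "dim_row (A @\<^sub>c B) = dim_row A" "dim_col (A @\<^sub>c B) = dim_col A + dim_col B"
  by (simp_all add: append_cols_def)

lemma append_cols_index:
  assumes "i < dim_row A" "j < dim_col A + dim_col B"
  shows "(A @\<^sub>c B) $$ (i, j) = (if j < dim_col A then A $$ (i, j) else B $$ (i, j - dim_col A))"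
  using assms by (simp add: append_cols_def)

lemma append_rows_index:
  assumes "i < dim_row A + dim_row B" "j < dim_col A"
  shows "(A @\<^sub>r B) $$ (i, j) = (if i < dim_row A then A $$ (i, j) else B $$ (i - dim_row A, j))"
  using assms by (simp add: append_rows_def)

lemma resultant_mat_index:
  assumes "i < 2 * k" "j < k"
  shows "resultant_mat k f1 f2 a b c d $$ (i, j) = syl k a $$ (i, j)"
    and "resultant_mat k f1 f2 a b c d $$ (i, k + j) = syl k (b * f2) $$ (i, j)"
    and "resultant_mat k f1 f2 a b c d $$ (i, 2 * k + j) = syl k c $$ (i, j)"
    and "resultant_mat k f1 f2 a b c d $$ (i, 3 * k + j) = syl k (d * f2) $$ (i, j)"
    and "resultant_mat k f1 f2 a b c d $$ (2 * k + i, j) = syl k (b * f1) $$ (i, j)"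
    and "resultant_mat k f1 f2 a b c d $$ (2 * k + i, k + j) = syl k a $$ (i, j)"
    and "resultant_mat k f1 f2 a b c d $$ (2 * k + i, 2 * k + j) = syl k (d * f1) $$ (i, j)"
    and "resultant_mat k f1 f2 a b c d $$ (2 * k + i, 3 * k + j) = syl k c $$ (i, j)"
  using assms by (simp_all add: resultant_mat_def append_rows_index append_cols_index)

lemma less_2k_cases:
  assumes "i < 4 * (k::nat)"
  obtains i' where "i' < 2 * k" "i = i' \<or> i = 2 * k + i'"
proof (cases "i < 2 * k")
  case False
  then show ?thesis using assms that[of "i - 2 * k"] by auto
qed (use that in auto)

lemma less_4k_cases:
  assumes "j < 4 * (k::nat)"
  obtains j' where "j' < k" "j = j' \<or> j = k + j' \<or> j = 2 * k + j' \<or> j = 3 * k + j'"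
proof -
  consider "j < k" | "k \<le> j" "j < 2 * k" | "2 * k \<le> j" "j < 3 * k" | "3 * k \<le> j" by linarith
  then show ?thesis
  proof cases
    case 1 then show ?thesis using that[of j] by auto
  next
    case 2 then show ?thesis using that[of "j - k"] by auto
  next
    case 3 then show ?thesis using that[of "j - 2 * k"] by auto
  next
    case 4 then show ?thesis using assms that[of "j - 3 * k"] by auto
  qed
qed

lemma sum_shift_concat:
  fixes h :: "nat \<Rightarrow> 'b::comm_monoid_add"
  shows "sum h {0..<m + n} = sum h {0..<m} + (\<Sum>j = 0..<n. h (m + j))"
  using sum.atLeastLessThan_concat[of 0 m "m + n" h] sum.shift_bounds_nat_ivl[of h 0 m n]
  by (simp add: add.commute)

lemma sum_split2:
  fixes h :: "nat \<Rightarrow> 'b::comm_monoid_add"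
  shows "sum h {0..<4 * k} = (\<Sum>i = 0..<2 * k. h i) + (\<Sum>i = 0..<2 * k. h (2 * k + i))"
  using sum_shift_concat[of h "2 * k" "2 * k"] by simp

lemma sum_split4:
  fixes h :: "nat \<Rightarrow> 'b::comm_monoid_add"
  shows "sum h {0..<4 * k} = (\<Sum>j = 0..<k. h j) + (\<Sum>j = 0..<k. h (k + j))
    + (\<Sum>j = 0..<k. h (2 * k + j)) + (\<Sum>j = 0..<k. h (3 * k + j))"
proof -
  have "4 * k = k + k + k + k" "3 * k = k + k + k" "2 * k = k + k" by simp_all
  then show ?thesis by (simp only: sum_shift_concat)
qed

section \<open>A common zero forces the determinant to vanish\<close>

text \<open>Column \<open>j\<close> lists the coefficients of \<open>t^j r\<close>, so pairing it
  with the monomials of degree \<open>2 k - 1\<close> evaluates a form that factors in degrees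
  \<open>k - 1\<close> and \<open>k\<close>.\<close>

lemma hom_eval_syl_col:
  fixes r :: "'a::field poly"
  assumes "Polynomial.degree r \<le> k" "j < k"
  shows "(\<Sum>i = 0..<2 * k. syl k r $$ (i, j) * (x ^ i * z ^ (2 * k - Suc i)))
    = hom_eval (k - 1) (Polynomial.monom 1 j) x z * hom_eval k r x z"
proof -
  have k: "k - 1 + k = 2 * k - 1" "{0..<2 * k} = {..2 * k - 1}" using assms(2) by auto
  have "(\<Sum>i = 0..<2 * k. syl k r $$ (i, j) * (x ^ i * z ^ (2 * k - Suc i)))
    = hom_eval (2 * k - 1) (Polynomial.monom 1 j * r) x z"
    unfolding hom_eval_def k(2)[symmetric]
    by (intro sum.cong) (auto simp: syl_index[OF assms(1) _ assms(2)] mult.assoc)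
  also have "\<dots> = hom_eval (k - 1) (Polynomial.monom 1 j) x z * hom_eval k r x z"
    unfolding k(1)[symmetric]
    by (rule hom_eval_mult) (use assms in \<open>auto simp: degree_monom_eq\<close>)
  finally show ?thesis .
qed

lemma det_resultant_mat_eq_0_if_common_zero:
  fixes f1 f2 a b c d :: "'a::field poly"
  assumes f1: "Polynomial.degree f1 \<le> g + 1" and f2: "Polynomial.degree f2 \<le> g + 1"
    and a: "Polynomial.degree a \<le> k" and b: "b = 0 \<or> g + 1 + Polynomial.degree b \<le> k"
    and c: "Polynomial.degree c \<le> k" and d: "d = 0 \<or> g + 1 + Polynomial.degree d \<le> k"
    and k: "k > 0"
    and xz: "(x, z) \<noteq> (0, 0)"
    and nz: "hom_eval (g + 1) f1 x z \<noteq> 0 \<or> hom_eval (g + 1) f2 x z \<noteq> 0"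
    and y: "y\<^sup>2 = hom_eval (g + 1) f1 x z * hom_eval (g + 1) f2 x z"
    and zero: "section_value g k a b (x, z, y) = 0" "section_value g k c d (x, z, y) = 0"
  shows "det (resultant_mat k f1 f2 a b c d) = 0"
proof -
  define F1 F2 where "F1 = hom_eval (g + 1) f1 x z" and "F2 = hom_eval (g + 1) f2 x z"
  \<comment> \<open>\<open>(\<alpha>, \<beta>)\<close> is a left eigenvector, with eigenvalue
    \<open>y\<close>, of the matrix with rows \<open>(0, F2)\<close> and \<open>(F1, 0)\<close> by
    which \<open>\<surd>f\<close> acts on the fibre. The vector \<open>(F1, y)\<close> serves unless
    \<open>F1 = 0\<close>; then \<open>F2 \<noteq> 0\<close> and \<open>(y, F2)\<close>
    serves.\<close>
  obtain \<alpha> \<beta> where ab: "\<alpha> \<noteq> 0 \<or> \<beta> \<noteq> 0" "\<beta> * F1 = y * \<alpha>" "\<alpha> * F2 = y * \<beta>"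
  proof (cases "F1 = 0")
    case False
    show ?thesis by (rule that[of F1 y]) (use False y in \<open>auto simp: F1_def F2_def power2_eq_square\<close>)
  next
    case True
    show ?thesis
      by (rule that[of y F2]) (use True nz y in \<open>auto simp: F1_def F2_def power2_eq_square\<close>)
  qed
  define w where "w = vec (4 * k) (\<lambda>i. if i < 2 * k then \<alpha> * (x ^ i * z ^ (2 * k - Suc i))
    else \<beta> * (x ^ (i - 2 * k) * z ^ (2 * k - Suc (i - 2 * k))))"
  define R where "R = resultant_mat k f1 f2 a b c d"
  have R: "R \<in> carrier_mat (4 * k) (4 * k)" unfolding R_def by (rule resultant_mat_carrier)
  have prod_deg: "Polynomial.degree (p * q) \<le> k"
    if "p = 0 \<or> g + 1 + Polynomial.degree p \<le> k" "Polynomial.degree q \<le> g + 1" for p q :: "'a poly"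
    using that degree_mult_le[of p q] by (cases "p = 0") auto
  note degs = a c prod_deg[OF b f1] prod_deg[OF b f2] prod_deg[OF d f1] prod_deg[OF d f2]
  have s: "hom_eval k a x z = - (hom_eval (k - (g + 1)) b x z * y)"
    "hom_eval k c x z = - (hom_eval (k - (g + 1)) d x z * y)"
    using zero by (simp_all add: section_value_def eq_neg_iff_add_eq_0)
  note he = hom_eval_mult_shift[OF b f1, of x z, folded F1_def]
    hom_eval_mult_shift[OF b f2, of x z, folded F2_def]
    hom_eval_mult_shift[OF d f1, of x z, folded F1_def]
    hom_eval_mult_shift[OF d f2, of x z, folded F2_def]
  have split: "(\<Sum>i = 0..<4 * k. R $$ (i, j) * w $ i)
    = \<alpha> * (\<Sum>i = 0..<2 * k. R $$ (i, j) * (x ^ i * z ^ (2 * k - Suc i)))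
    + \<beta> * (\<Sum>i = 0..<2 * k. R $$ (2 * k + i, j) * (x ^ i * z ^ (2 * k - Suc i)))" for j
    unfolding sum_split2 sum_distrib_left
    by (intro arg_cong2[where f = "(+)"] sum.cong) (auto simp: w_def)
  have col: "(\<Sum>i = 0..<4 * k. R $$ (i, j) * w $ i) = 0" if j: "j < 4 * k" for j
  proof -
    obtain j' where j': "j' < k" "j = j' \<or> j = k + j' \<or> j = 2 * k + j' \<or> j = 3 * k + j'"
      using less_4k_cases[OF j] .
    define m where "m = hom_eval (k - 1) (Polynomial.monom 1 j') x z"
    note e = hom_eval_syl_col[OF _ j'(1), of _ x z, folded m_def]
    \<comment> \<open>\<open>B\<close> is the value of \<open>b\<close> or \<open>d\<close> at the
      point. Substituting \<open>- B y\<close> for the value of \<open>a\<close> or \<open>c\<close>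
      turns the pairing of \<open>w\<close> with any column into one of these expressions.\<close>
    have eigen: "\<alpha> * (m * (B * F2)) - \<beta> * (m * (B * y)) = 0"
      "\<beta> * (m * (B * F1)) - \<alpha> * (m * (B * y)) = 0" for B
    proof -
      have "\<alpha> * (m * (B * F2)) - \<beta> * (m * (B * y)) = m * B * (\<alpha> * F2 - y * \<beta>)"
        "\<beta> * (m * (B * F1)) - \<alpha> * (m * (B * y)) = m * B * (\<beta> * F1 - y * \<alpha>)"
        by (simp_all add: algebra_simps)
      then show "\<alpha> * (m * (B * F2)) - \<beta> * (m * (B * y)) = 0"
        "\<beta> * (m * (B * F1)) - \<alpha> * (m * (B * y)) = 0" using ab by simp_all
    qed
    show ?thesis using j'(2)
      by (elim disjE; simp only: split)
        (simp_all add: R_def resultant_mat_index[OF _ j'(1)] e degs s he eigen)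
  qed
  have "transpose_mat R *\<^sub>v w = 0\<^sub>v (4 * k)"
  proof (rule eq_vecI)
    fix j assume "j < dim_vec (0\<^sub>v (4 * k) :: 'a vec)"
    then show "(transpose_mat R *\<^sub>v w) $ j = 0\<^sub>v (4 * k) $ j"
      using R col[of j] by (simp add: scalar_prod_def w_def)
  qed (use R in auto)
  moreover have "w \<noteq> 0\<^sub>v (4 * k)"
  proof
    assume w0: "w = 0\<^sub>v (4 * k)"
    have w_lo: "\<alpha> * (x ^ i * z ^ (2 * k - Suc i)) = 0" if "i < 2 * k" for i
      using arg_cong[OF w0, of "\<lambda>v. vec_index v i"] that by (simp add: w_def)
    have w_hi: "\<beta> * (x ^ i * z ^ (2 * k - Suc i)) = 0" if "i < 2 * k" for i
      using arg_cong[OF w0, of "\<lambda>v. vec_index v (2 * k + i)"] that by (simp add: w_def)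
    \<comment> \<open>Some monomial of degree \<open>2 k - 1\<close> is nonzero at the point: the
      power of \<open>x\<close> if \<open>z = 0\<close>, the power of \<open>z\<close>
      otherwise.\<close>
    show False
    proof (cases "z = 0")
      case True
      then show False
        using w_lo[of "2 * k - 1"] w_hi[of "2 * k - 1"] ab(1) xz k by simp
    next
      case False
      then show False
        using w_lo[of 0] w_hi[of 0] ab(1) k by simp
    qed
  qed
  moreover have "w \<in> carrier_vec (4 * k)" by (simp add: w_def)
  ultimately have "det (transpose_mat R) = 0"
    using det_0_iff_vec_prod_zero[of "transpose_mat R" "4 * k"] R by auto
  then show ?thesis using det_transpose[OF R] by (simp add: R_def)
qed

section \<open>Without a common zero the matrix is injective\<close>

text \<open>The first two equations are the vanishing of norms. If \<open>B \<noteq> 0\<close>, then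
  \<open>y = - A / B\<close> is forced and the third equation carries it over to
  \<open>C + D y\<close>; the case \<open>D \<noteq> 0\<close> is alike. If
  \<open>B = D = 0\<close>, then \<open>A = C = 0\<close> and any square root of \<open>F\<close>
  serves.\<close>

lemma common_root_of_norms:
  fixes A B C D F :: "'a::alg_closed_field"
  assumes "A\<^sup>2 = B\<^sup>2 * F" "C\<^sup>2 = D\<^sup>2 * F" "A * D = B * C"
  shows "\<exists>y. y\<^sup>2 = F \<and> A + B * y = 0 \<and> C + D * y = 0"
proof -
  consider "B \<noteq> 0" | "B = 0" "D \<noteq> 0" | "B = 0" "D = 0" by blast
  then show ?thesis
  proof cases
    case 1
    then show ?thesis using assms
      by (intro exI[of _ "- A / B"]) (auto simp: field_simps power2_eq_square)
  next
    case 2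
    then show ?thesis using assms
      by (intro exI[of _ "- C / D"]) (auto simp: field_simps power2_eq_square)
  next
    case 3
    obtain y where "y\<^sup>2 = F" using nth_root_exists[of 2 F] by auto
    then show ?thesis using 3 assms by auto
  qed
qed

text \<open>By division with remainder, a nonzero element of least degree in the ideal divides
  \<open>p\<close>, \<open>q\<close> and \<open>r\<close>. A root of it would be a common root, so
  it is a constant.\<close>

lemma bezout_of_no_common_root:
  fixes p q r :: "'a::alg_closed_field poly"
  assumes "\<And>t. \<not> (poly p t = 0 \<and> poly q t = 0 \<and> poly r t = 0)"
  obtains u v w where "u * p + v * q + w * r = 1"
proof -
  define I where "I = {e. \<exists>u v w. e = u * p + v * q + w * r}"
  have I_gens: "p \<in> I" "q \<in> I" "r \<in> I"
    unfolding I_def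
    by (auto intro: exI[of _ 1] exI[of _ 0])
       (metis add.left_neutral add.right_neutral mult_1 mult_zero_left)+
  have I_sub: "e - m * h \<in> I" if eh: "e \<in> I" "h \<in> I" for e h m
  proof -
    obtain u v w u' v' w' where
      "e = u * p + v * q + w * r" "h = u' * p + v' * q + w' * r"
      using eh by (auto simp: I_def)
    then have "e - m * h = (u - m * u') * p + (v - m * v') * q + (w - m * w') * r"
      by (simp add: algebra_simps)
    then show ?thesis unfolding I_def by blast
  qed
  have "\<exists>e. e \<in> I \<and> e \<noteq> 0" using assms[of 0] I_gens by (metis poly_0)
  then obtain e where e: "e \<in> I" "e \<noteq> 0"
    and min: "\<And>h. h \<in> I \<and> h \<noteq> 0 \<Longrightarrow> Polynomial.degree e \<le> Polynomial.degree h"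
    using ex_has_least_nat[of "\<lambda>e. e \<in> I \<and> e \<noteq> 0" _ Polynomial.degree] by metis
  have dvd: "e dvd h" if h: "h \<in> I" for h
  proof (rule ccontr)
    assume "\<not> e dvd h"
    then have nz: "h mod e \<noteq> 0" by (simp add: dvd_eq_mod_eq_0)
    have "h mod e \<in> I" using I_sub[OF h e(1), of "h div e"] by (simp add: minus_div_mult_eq_mod)
    then show False using min[of "h mod e"] nz degree_mod_less[of e h] e(2) by auto
  qed
  have "Polynomial.degree e = 0"
  proof (rule ccontr)
    assume "Polynomial.degree e \<noteq> 0"
    then obtain t where "poly e t = 0" using alg_closed_imp_poly_has_root[of e] by auto
    then show False using assms[of t] dvd[OF I_gens(1)] dvd[OF I_gens(2)] dvd[OF I_gens(3)]
      by (auto elim!: dvdE)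
  qed
  then have "e dvd 1" using e(2) is_unit_iff_degree by blast
  then obtain l where l: "1 = e * l" by (elim dvdE)
  obtain u v w where "e = u * p + v * q + w * r" using e(1) by (auto simp: I_def)
  then have "l * u * p + l * v * q + l * w * r = 1" unfolding l by (simp add: algebra_simps)
  then show ?thesis by (rule that)
qed

text \<open>
  A pair \<open>(p1, p2)\<close> stands for \<open>p1 + p2 \<surd>f/f1\<close>. With \<open>u (a^2 - b^2 f) + v (c^2 - d^2 f) +
  w (a d - b c) = 1\<close>, one has \<open>s U + s' V = 1\<close> for \<open>U = u (a - b \<surd>f) + w d\<close> and
  \<open>V = v (c - d \<surd>f) - w b\<close>, and \<open>W = V P - U Q\<close>.
\<close>

lemma koszul_exact:
  fixes f1 f2 a b c d p1 p2 q1 q2 u v w :: "'a::comm_ring_1"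
  assumes bez: "u * (a\<^sup>2 - b\<^sup>2 * (f1 * f2)) + v * (c\<^sup>2 - d\<^sup>2 * (f1 * f2)) + w * (a * d - b * c) = 1"
    and ker: "a * p1 + b * f2 * p2 + c * q1 + d * f2 * q2 = 0"
      "b * f1 * p1 + a * p2 + d * f1 * q1 + c * q2 = 0"
  obtains w1 w2 where "p1 = c * w1 + d * f2 * w2" "p2 = d * f1 * w1 + c * w2"
    "q1 = - (a * w1 + b * f2 * w2)" "q2 = - (b * f1 * w1 + a * w2)"
proof (rule that)
  define U0 U1 V0 V1 where "U0 = u * a + w * d" and "U1 = - (u * b)"
    and "V0 = v * c - w * b" and "V1 = - (v * d)"
  define w1 w2 where "w1 = V0 * p1 + V1 * f2 * p2 - (U0 * q1 + U1 * f2 * q2)"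
    and "w2 = V1 * f1 * p1 + V0 * p2 - (U1 * f1 * q1 + U0 * q2)"
  \<comment> \<open>\<open>one\<close> and \<open>zero\<close> are the two components of
    \<open>s U + s' V = 1\<close>.\<close>
  have one: "a * U0 + b * U1 * (f1 * f2) + (c * V0 + d * V1 * (f1 * f2)) = 1"
    using bez by (simp add: U0_def U1_def V0_def V1_def algebra_simps power2_eq_square)
  have zero: "a * U1 + b * U0 + (c * V1 + d * V0) = 0"
    by (simp add: U0_def U1_def V0_def V1_def algebra_simps)
  \<comment> \<open>The four identities below are the coordinates of
    \<open>s' W = (s U + s' V) P - U (s P + s' Q)\<close> and
    \<open>- s W = (s U + s' V) Q - V (s P + s' Q)\<close>.\<close>
  let ?one = "a * U0 + b * U1 * (f1 * f2) + (c * V0 + d * V1 * (f1 * f2))"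
  let ?zero = "a * U1 + b * U0 + (c * V1 + d * V0)"
  let ?E1 = "a * p1 + b * f2 * p2 + c * q1 + d * f2 * q2"
  let ?E2 = "b * f1 * p1 + a * p2 + d * f1 * q1 + c * q2"
  have "c * w1 + d * f2 * w2 = p1 * ?one + f2 * p2 * ?zero - (U0 * ?E1 + U1 * f2 * ?E2)"
    unfolding w1_def w2_def by (simp add: algebra_simps)
  then show "p1 = c * w1 + d * f2 * w2" unfolding one zero ker by simp
  have "d * f1 * w1 + c * w2 = f1 * p1 * ?zero + p2 * ?one - (U1 * f1 * ?E1 + U0 * ?E2)"
    unfolding w1_def w2_def by (simp add: algebra_simps)
  then show "p2 = d * f1 * w1 + c * w2" unfolding one zero ker by simp
  have "- (a * w1 + b * f2 * w2) = q1 * ?one + f2 * q2 * ?zero - (V0 * ?E1 + V1 * f2 * ?E2)"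
    unfolding w1_def w2_def by (simp add: algebra_simps)
  then show "q1 = - (a * w1 + b * f2 * w2)" unfolding one zero ker by simp
  have "- (b * f1 * w1 + a * w2) = f1 * q1 * ?zero + q2 * ?one - (V1 * f1 * ?E1 + V0 * ?E2)"
    unfolding w1_def w2_def by (simp add: algebra_simps)
  then show "q2 = - (b * f1 * w1 + a * w2)" unfolding one zero ker by simp
qed

text \<open>Two matrices with a nonzero kernel vector have determinant zero, and eliminating between
  their first rows gives the third equation up to the factor \<open>l2\<close>. The conclusions are
  what \<open>common_root_of_norms\<close> requires at infinity.\<close>

lemma norms_eq_of_common_kernel:
  fixes A B C D l1 l2 w1 w2 :: "'a::idom"
  assumes w: "w1 \<noteq> 0 \<or> w2 \<noteq> 0" and l: "l1 \<noteq> 0" "l2 \<noteq> 0"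
    and "A * w1 + B * l2 * w2 = 0" "B * l1 * w1 + A * w2 = 0"
    and "C * w1 + D * l2 * w2 = 0" "D * l1 * w1 + C * w2 = 0"
  shows "A\<^sup>2 = B\<^sup>2 * (l1 * l2)" "C\<^sup>2 = D\<^sup>2 * (l1 * l2)" "A * D = B * C"
proof -
  let ?e1 = "A * w1 + B * l2 * w2" and ?e2 = "B * l1 * w1 + A * w2"
  let ?e3 = "C * w1 + D * l2 * w2" and ?e4 = "D * l1 * w1 + C * w2"
  have "(A\<^sup>2 - B\<^sup>2 * (l1 * l2)) * w1 = A * ?e1 - B * l2 * ?e2"
    "(A\<^sup>2 - B\<^sup>2 * (l1 * l2)) * w2 = A * ?e2 - B * l1 * ?e1"
    "(C\<^sup>2 - D\<^sup>2 * (l1 * l2)) * w1 = C * ?e3 - D * l2 * ?e4"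
    "(C\<^sup>2 - D\<^sup>2 * (l1 * l2)) * w2 = C * ?e4 - D * l1 * ?e3"
    "l2 * (A * D - B * C) * w1 = D * l2 * ?e1 - B * l2 * ?e3"
    "l2 * (A * D - B * C) * w2 = A * ?e3 - C * ?e1"
    by (simp_all add: algebra_simps power2_eq_square)
  then have "(A\<^sup>2 - B\<^sup>2 * (l1 * l2)) * w1 = 0" "(A\<^sup>2 - B\<^sup>2 * (l1 * l2)) * w2 = 0"
    "(C\<^sup>2 - D\<^sup>2 * (l1 * l2)) * w1 = 0" "(C\<^sup>2 - D\<^sup>2 * (l1 * l2)) * w2 = 0"
    "l2 * (A * D - B * C) * w1 = 0" "l2 * (A * D - B * C) * w2 = 0"
    using assms(4-7) by (simp_all only: mult_zero_right diff_self)
  then show "A\<^sup>2 = B\<^sup>2 * (l1 * l2)" "C\<^sup>2 = D\<^sup>2 * (l1 * l2)" "A * D = B * C"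
    using w l by auto
qed

section \<open>Kernel vectors as polynomial relations of bounded degree\<close>

lemma coeff_sum_monom:
  "poly.coeff (\<Sum>j = 0..<k. Polynomial.monom (v j) j) i = (if i < k then v i else 0)"
  by (simp add: coeff_sum)

lemma syl_mult_coeffs:
  fixes r :: "'a::comm_semiring_1 poly"
  assumes "Polynomial.degree r \<le> k" "i < 2 * k"
  shows "(\<Sum>j = 0..<k. syl k r $$ (i, j) * v j)
    = poly.coeff (r * (\<Sum>j = 0..<k. Polynomial.monom (v j) j)) i"
proof -
  have "Polynomial.monom (v j) j = Polynomial.smult (v j) (Polynomial.monom 1 j)" for j
    by (simp add: smult_monom)
  then have "r * (\<Sum>j = 0..<k. Polynomial.monom (v j) j)
    = (\<Sum>j = 0..<k. Polynomial.smult (v j) (Polynomial.monom 1 j * r))"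
    by (simp add: sum_distrib_left mult.commute)
  then show ?thesis
    using assms by (simp add: coeff_sum syl_index mult.commute)
qed

text \<open>A kernel vector is cut into four blocks of length \<open>k\<close>, the coefficients of
  \<open>p1\<close>, \<open>p2\<close>, \<open>q1\<close> and \<open>q2\<close>.\<close>

lemma det_resultant_mat_eq_0D:
  fixes f1 f2 a b c d :: "'a::field poly"
  assumes degs: "Polynomial.degree a \<le> k" "Polynomial.degree (b * f1) \<le> k"
      "Polynomial.degree (b * f2) \<le> k" "Polynomial.degree c \<le> k"
      "Polynomial.degree (d * f1) \<le> k" "Polynomial.degree (d * f2) \<le> k"
    and det: "det (resultant_mat k f1 f2 a b c d) = 0"
  obtains p1 p2 q1 q2 where "p1 \<noteq> 0 \<or> p2 \<noteq> 0 \<or> q1 \<noteq> 0 \<or> q2 \<noteq> 0"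
    "\<forall>i\<ge>k. poly.coeff p1 i = 0" "\<forall>i\<ge>k. poly.coeff p2 i = 0"
    "\<forall>i\<ge>k. poly.coeff q1 i = 0" "\<forall>i\<ge>k. poly.coeff q2 i = 0"
    "a * p1 + b * f2 * p2 + c * q1 + d * f2 * q2 = 0"
    "b * f1 * p1 + a * p2 + d * f1 * q1 + c * q2 = 0"
proof -
  define R where "R = resultant_mat k f1 f2 a b c d"
  have R: "R \<in> carrier_mat (4 * k) (4 * k)" unfolding R_def by (rule resultant_mat_carrier)
  obtain v where v: "v \<in> carrier_vec (4 * k)" "v \<noteq> 0\<^sub>v (4 * k)" "R *\<^sub>v v = 0\<^sub>v (4 * k)"
    using det det_0_iff_vec_prod_zero[OF R] by (auto simp: R_def)
  define part where "part n = (\<Sum>j = 0..<k. Polynomial.monom (v $ (n + j)) j)" for n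
  have coeff_part: "poly.coeff (part n) i = (if i < k then v $ (n + i) else 0)" for n i
    unfolding part_def by (rule coeff_sum_monom)
  have row: "(\<Sum>j = 0..<4 * k. R $$ (i, j) * v $ j) = 0" if "i < 4 * k" for i
  proof -
    have "(R *\<^sub>v v) $ i = 0" using v(3) that by simp
    then show ?thesis using R v(1) that by (simp add: scalar_prod_def)
  qed
  have syl_part: "(\<Sum>j = 0..<k. syl k r $$ (i, j) * v $ (n + j)) = poly.coeff (r * part n) i"
    if "Polynomial.degree r \<le> k" "i < 2 * k" for r n i
    unfolding part_def by (rule syl_mult_coeffs[OF that])
  \<comment> \<open>The rows only see coefficients below \<open>2 k\<close>; the higher ones vanish
    by degree, so the rows yield full polynomial equations.\<close>
  have deg_prod: "poly.coeff (r * part n) i = 0"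
    if "Polynomial.degree r \<le> k" "i \<ge> 2 * k" for r n i
  proof (cases "k = 0")
    case True
    then show ?thesis by (simp add: part_def)
  next
    case False
    have "Polynomial.degree (part n) \<le> k - 1"
      by (rule degree_le) (auto simp: coeff_part)
    then have "Polynomial.degree (r * part n) < i"
      using degree_mult_le[of r "part n"] that False by linarith
    then show ?thesis by (rule coeff_eq_0)
  qed
  show ?thesis
  proof (rule that)
    show "part 0 \<noteq> 0 \<or> part k \<noteq> 0 \<or> part (2 * k) \<noteq> 0 \<or> part (3 * k) \<noteq> 0"
    proof (rule ccontr)
      assume *: "\<not> ?thesis"
      have part0: "v $ (n + i) = 0" if "i < k" "part n = 0" for n i
        using coeff_part[of n i] that by simp
      have "v $ j = 0" if "j < 4 * k" for j
        using less_4k_cases[OF that] part0[of _ 0] part0[of _ k] part0[of _ "2 * k"]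
          part0[of _ "3 * k"] * by (metis add_0)
      then show False using v(1,2) by (metis carrier_vecD eq_vecI index_zero_vec(1,2))
    qed
    show "a * part 0 + b * f2 * part k + c * part (2 * k) + d * f2 * part (3 * k) = 0"
    proof (rule poly_eqI)
      fix i
      show "poly.coeff (a * part 0 + b * f2 * part k + c * part (2 * k) + d * f2 * part (3 * k)) i
        = poly.coeff 0 i"
      proof (cases "i < 2 * k")
        case True
        then show ?thesis using row[of i] syl_part[OF degs(1) True, of 0]
          by (simp add: sum_split4 R_def resultant_mat_index syl_part degs)
      next
        case False
        then show ?thesis by (simp add: deg_prod degs)
      qed
    qed
    show "b * f1 * part 0 + a * part k + d * f1 * part (2 * k) + c * part (3 * k) = 0"
    proof (rule poly_eqI)
      fix i
      show "poly.coeff (b * f1 * part 0 + a * part k + d * f1 * part (2 * k) + c * part (3 * k)) i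
        = poly.coeff 0 i"
      proof (cases "i < 2 * k")
        case True
        then show ?thesis using row[of "2 * k + i"] syl_part[OF degs(2) True, of 0]
          by (simp add: sum_split4 R_def resultant_mat_index syl_part degs)
      next
        case False
        then show ?thesis by (simp add: deg_prod degs)
      qed
    qed
  qed (simp_all add: coeff_part)
qed

lemma common_zero_if_det_resultant_mat_eq_0:
  fixes f1 f2 a b c d :: "'a::alg_closed_field poly"
  assumes f1: "Polynomial.degree f1 = g + 1" and f2: "Polynomial.degree f2 = g + 1"
    and a: "Polynomial.degree a \<le> k" and b: "b = 0 \<or> g + 1 + Polynomial.degree b \<le> k"
    and c: "Polynomial.degree c \<le> k" and d: "d = 0 \<or> g + 1 + Polynomial.degree d \<le> k"
    and det: "det (resultant_mat k f1 f2 a b c d) = 0"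
  shows "\<exists>u\<in>curve_coords g (f1 * f2). section_value g k a b u = 0 \<and> section_value g k c d u = 0"
proof (rule ccontr)
  assume no_zero: "\<not> ?thesis"
  have nz: "f1 \<noteq> 0" "f2 \<noteq> 0" using f1 f2 by auto
  have deg_f: "Polynomial.degree (f1 * f2) = 2 * g + 2" using f1 f2 nz by (simp add: degree_mult_eq)
  have prod_deg: "Polynomial.degree (p * q) \<le> k"
    if "p = 0 \<or> g + 1 + Polynomial.degree p \<le> k" "Polynomial.degree q = g + 1" for p q :: "'a poly"
    using that degree_mult_le[of p q] by (cases "p = 0") auto
  obtain p1 p2 q1 q2 where pq: "p1 \<noteq> 0 \<or> p2 \<noteq> 0 \<or> q1 \<noteq> 0 \<or> q2 \<noteq> 0"
    "\<forall>i\<ge>k. poly.coeff p1 i = 0" "\<forall>i\<ge>k. poly.coeff p2 i = 0"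
    "\<forall>i\<ge>k. poly.coeff q1 i = 0" "\<forall>i\<ge>k. poly.coeff q2 i = 0"
    "a * p1 + b * f2 * p2 + c * q1 + d * f2 * q2 = 0"
    "b * f1 * p1 + a * p2 + d * f1 * q1 + c * q2 = 0"
    using det_resultant_mat_eq_0D[OF a prod_deg[OF b f1] prod_deg[OF b f2] c
      prod_deg[OF d f1] prod_deg[OF d f2] det] .
  \<comment> \<open>The three polynomials are the norms of the two sections and the determinant of
    their coefficients; a common root \<open>t\<close> lifts to a point \<open>(t, 1, y)\<close>
    where both sections vanish.\<close>
  have "\<not> (poly (a\<^sup>2 - b\<^sup>2 * (f1 * f2)) t = 0 \<and> poly (c\<^sup>2 - d\<^sup>2 * (f1 * f2)) t = 0
    \<and> poly (a * d - b * c) t = 0)" for t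
  proof
    assume "poly (a\<^sup>2 - b\<^sup>2 * (f1 * f2)) t = 0 \<and> poly (c\<^sup>2 - d\<^sup>2 * (f1 * f2)) t = 0
      \<and> poly (a * d - b * c) t = 0"
    then obtain y where "y\<^sup>2 = poly (f1 * f2) t" "poly a t + poly b t * y = 0"
      "poly c t + poly d t * y = 0"
      using common_root_of_norms[of "poly a t" "poly b t" "poly (f1 * f2) t" "poly c t" "poly d t"]
      by auto
    moreover from this(1) have "(t, 1, y) \<in> curve_coords g (f1 * f2)"
      using hom_eval_affine[of "f1 * f2" "2 * g + 2" t] deg_f by (simp add: curve_coords_def)
    ultimately show False
      using no_zero section_value_affine[OF a b, of t y] section_value_affine[OF c d, of t y] by auto
  qed
  then obtain u v w where
    "u * (a\<^sup>2 - b\<^sup>2 * (f1 * f2)) + v * (c\<^sup>2 - d\<^sup>2 * (f1 * f2)) + w * (a * d - b * c) = 1"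
    by (rule bezout_of_no_common_root)
  then obtain w1 w2 where W: "p1 = c * w1 + d * f2 * w2" "p2 = d * f1 * w1 + c * w2"
    "q1 = - (a * w1 + b * f2 * w2)" "q2 = - (b * f1 * w1 + a * w2)"
    using koszul_exact pq(6,7) by metis
  define n where "n = max (Polynomial.degree w1) (Polynomial.degree w2)"
  have n: "Polynomial.degree w1 \<le> n" "Polynomial.degree w2 \<le> n" by (auto simp: n_def)
  \<comment> \<open>One of these coefficients may be zero, but not both, since \<open>W = 0\<close>
    would give \<open>P = Q = 0\<close>.\<close>
  have lead: "poly.coeff w1 n \<noteq> 0 \<or> poly.coeff w2 n \<noteq> 0"
  proof (rule ccontr)
    assume "\<not> ?thesis"
    then have "w1 = 0 \<and> w2 = 0"
      by (metis leading_coeff_0_iff max_def n_def degree_0 le_zero_eq nle_le)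
    then show False using pq(1) W by simp
  qed
  define l1 l2 where "l1 = poly.coeff f1 (g + 1)" and "l2 = poly.coeff f2 (g + 1)"
  have l: "l1 \<noteq> 0" "l2 \<noteq> 0" using nz f1 f2 by (metis l1_def l2_def leading_coeff_0_iff)+
  \<comment> \<open>At a point \<open>(1, 0, y)\<close> the two sections take the values
    \<open>A + B y\<close> and \<open>C + D y\<close>.\<close>
  define A B C D where "A = poly.coeff a k" and "B = poly.coeff b (k - (g + 1))"
    and "C = poly.coeff c k" and "D = poly.coeff d (k - (g + 1))"
  have top: "poly.coeff (p * q * w') (k + n) = poly.coeff p (k - (g + 1)) * poly.coeff q (g + 1) * poly.coeff w' n"
    if "p = 0 \<or> g + 1 + Polynomial.degree p \<le> k" "Polynomial.degree q = g + 1" "Polynomial.degree w' \<le> n"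
    for p q w' :: "'a poly"
    using coeff_mult_degree_bounds[OF prod_deg[OF that(1,2)] that(3)]
      hom_eval_mult_shift[of p "g + 1" k q 1 0] that by (simp add: hom_eval_infinity)
  note tops = coeff_mult_degree_bounds[OF a n(1)] coeff_mult_degree_bounds[OF a n(2)]
    coeff_mult_degree_bounds[OF c n(1)] coeff_mult_degree_bounds[OF c n(2)]
    top[OF b f1 n(1)] top[OF b f2 n(2)] top[OF d f1 n(1)] top[OF d f2 n(2)]
  \<comment> \<open>\<open>p1\<close> and \<open>p2\<close> have degree \<open>< k\<close>, so the
    coefficient of \<open>s' W\<close> in degree \<open>k + n\<close> is zero; likewise below for
    \<open>q1\<close>, \<open>q2\<close> and \<open>s W\<close>.\<close>
  have top_p: "C * poly.coeff w1 n + D * l2 * poly.coeff w2 n = 0"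
      "D * l1 * poly.coeff w1 n + C * poly.coeff w2 n = 0"
    using pq(2)[rule_format, of "k + n"] pq(3)[rule_format, of "k + n"] tops by (simp_all add: W C_def D_def l1_def l2_def)
  have top_q: "A * poly.coeff w1 n + B * l2 * poly.coeff w2 n = 0"
      "B * l1 * poly.coeff w1 n + A * poly.coeff w2 n = 0"
    using arg_cong[OF pq(4)[rule_format, of "k + n"], of uminus] arg_cong[OF pq(5)[rule_format, of "k + n"], of uminus] tops
    by (simp_all add: W A_def B_def l1_def l2_def add.commute)
  obtain y where y: "y\<^sup>2 = l1 * l2" "A + B * y = 0" "C + D * y = 0"
    using common_root_of_norms[OF norms_eq_of_common_kernel[OF lead l top_q top_p]] by auto
  have "poly.coeff (f1 * f2) (2 * g + 2) = l1 * l2"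
    using coeff_mult_degree_bounds[of f1 "g + 1" f2 "g + 1"] f1 f2 by (simp add: l1_def l2_def mult_2)
  then have "(1, 0, y) \<in> curve_coords g (f1 * f2)"
    using y(1) by (simp add: curve_coords_def hom_eval_infinity)
  then show False
    using no_zero y(2,3) by (auto simp: section_value_infinity A_def B_def C_def D_def)
qed

section \<open>Passage to the algebraic closure\<close>

lemma map_poly_to_ac_mult:
  "map_poly to_ac (p * q) = map_poly to_ac p * map_poly to_ac q"
  by (rule poly_eqI) (simp add: coeff_map_poly coeff_mult to_ac_sum)

lemma degree_map_poly_to_ac [simp]: "Polynomial.degree (map_poly to_ac p) = Polynomial.degree p"
  by (rule degree_map_poly) simp

lemma map_poly_to_ac_eq_0_iff [simp]: "map_poly to_ac p = 0 \<longleftrightarrow> p = 0"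
  by (rule map_poly_eq_0_iff) auto

lemma to_ac_syl:
  assumes "i < 2 * k" "j < k"
  shows "to_ac (syl k r $$ (i, j)) = syl k (map_poly to_ac r) $$ (i, j)"
  using assms by (auto simp: syl_def coeff_map_poly)

lemma map_mat_to_ac_resultant_mat:
  "map_mat to_ac (resultant_mat k f1 f2 a b c d)
    = resultant_mat k (map_poly to_ac f1) (map_poly to_ac f2) (map_poly to_ac a) (map_poly to_ac b)
        (map_poly to_ac c) (map_poly to_ac d)" (is "map_mat to_ac ?R = ?S")
proof (rule eq_matI)
  have R: "?R \<in> carrier_mat (4 * k) (4 * k)" and S: "?S \<in> carrier_mat (4 * k) (4 * k)"
    by (rule resultant_mat_carrier)+
  then show "dim_row (map_mat to_ac ?R) = dim_row ?S" "dim_col (map_mat to_ac ?R) = dim_col ?S"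
    by auto
  fix i j assume "i < dim_row ?S" "j < dim_col ?S"
  then have ij: "i < 4 * k" "j < 4 * k" using S by auto
  obtain i' where i': "i' < 2 * k" "i = i' \<or> i = 2 * k + i'" using less_2k_cases[OF ij(1)] .
  obtain j' where j': "j' < k" "j = j' \<or> j = k + j' \<or> j = 2 * k + j' \<or> j = 3 * k + j'"
    using less_4k_cases[OF ij(2)] .
  have "map_mat to_ac ?R $$ (i, j) = to_ac (?R $$ (i, j))" using ij R by auto
  also have "\<dots> = ?S $$ (i, j)"
    using i'(2) j'(2)
    by (elim disjE; simp add: resultant_mat_index[OF i'(1) j'(1)] to_ac_syl[OF i'(1) j'(1)]
        map_poly_to_ac_mult)
  finally show "map_mat to_ac ?R $$ (i, j) = ?S $$ (i, j)" .
qed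

interpretation to_ac_hom: comm_ring_hom to_ac
  by unfold_locales auto

text \<open>Along a class the value of a section is multiplied by nonzero factors
  \<open>l ^ k\<close>, so its vanishing can be tested on one representative.\<close>

lemma have_common_zero_iff:
  assumes "b = 0 \<or> g + 1 \<le> k" "d = 0 \<or> g + 1 \<le> k"
  shows "have_common_zero g f k a b c d \<longleftrightarrow>
    (\<exists>u\<in>curve_coords g (map_poly to_ac f).
       section_value g k (map_poly to_ac a) (map_poly to_ac b) u = 0 \<and>
       section_value g k (map_poly to_ac c) (map_poly to_ac d) u = 0)"
proof -
  have "map_poly to_ac b = 0 \<or> g + 1 \<le> k" "map_poly to_ac d = 0 \<or> g + 1 \<le> k"
    using assms by auto
  then show ?thesis
    unfolding have_common_zero_def hyperelliptic_curve_def quotient_def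
    by (simp add: section_zero_at_class)
qed

lemma ext_degree_le_iff: "ext_degree p \<le> ereal (real k) \<longleftrightarrow> p = 0 \<or> Polynomial.degree p \<le> k"
  by (simp add: ext_degree_def)

text \<open>For \<open>p = 0\<close> the left side is \<open>- \<infinity>\<close>, so no bound on
  \<open>m\<close> follows.\<close>

lemma add_ext_degree_le_iff:
  "ereal (real m) + ext_degree p \<le> ereal (real k) \<longleftrightarrow> p = 0 \<or> m + Polynomial.degree p \<le> k"
  by (auto simp: ext_degree_def simp flip: of_nat_add)

theorem proposition4p6:
  fixes f f1 f2 a b c d :: "'a::field poly" and g k :: nat
  assumes "CHAR('a) \<noteq> 2"
    and "Polynomial.degree f = 2 * g + 2"
    and "rsquarefree (map_poly to_ac f)"
    and "f = f1 * f2"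
    and "Polynomial.degree f1 = g + 1"
    and "Polynomial.degree f2 = g + 1"
    and "\<not> (a = 0 \<and> b = 0 \<and> c = 0 \<and> d = 0)"
    and "ereal (real k) =
      Max {ext_degree a, ereal (real (g + 1)) + ext_degree b,
           ext_degree c, ereal (real (g + 1)) + ext_degree d}"
  shows "have_common_zero g f k a b c d \<longleftrightarrow> det (resultant_mat k f1 f2 a b c d) = 0"
proof -
  let ?h = "map_poly to_ac"
  define M where "M = {ext_degree a, ereal (real (g + 1)) + ext_degree b,
           ext_degree c, ereal (real (g + 1)) + ext_degree d}"
  have "x \<le> ereal (real k)" if "x \<in> M" for x
    unfolding assms(8) M_def[symmetric] by (rule Max_ge) (use that in \<open>auto simp: M_def\<close>)
  then have "ext_degree a \<le> ereal (real k)" "ereal (real (g + 1)) + ext_degree b \<le> ereal (real k)"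
    "ext_degree c \<le> ereal (real k)" "ereal (real (g + 1)) + ext_degree d \<le> ereal (real k)"
    by (auto simp: M_def)
  then have a: "Polynomial.degree a \<le> k" and b: "b = 0 \<or> g + 1 + Polynomial.degree b \<le> k"
    and c: "Polynomial.degree c \<le> k" and d: "d = 0 \<or> g + 1 + Polynomial.degree d \<le> k"
    unfolding ext_degree_le_iff add_ext_degree_le_iff by auto
  have fh: "?h f = ?h f1 * ?h f2" using assms(4) by (simp add: map_poly_to_ac_mult)
  define S where "S = resultant_mat k (?h f1) (?h f2) (?h a) (?h b) (?h c) (?h d)"
  have "det S = to_ac (det (resultant_mat k f1 f2 a b c d))"
    unfolding S_def map_mat_to_ac_resultant_mat[symmetric] by (rule to_ac_hom.hom_det)
  then have det: "det (resultant_mat k f1 f2 a b c d) = 0 \<longleftrightarrow> det S = 0" by simp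
  have zero: "have_common_zero g f k a b c d \<longleftrightarrow> (\<exists>u\<in>curve_coords g (?h f1 * ?h f2).
       section_value g k (?h a) (?h b) u = 0 \<and> section_value g k (?h c) (?h d) u = 0)"
    unfolding fh[symmetric] by (rule have_common_zero_iff) (use b d in auto)
  show ?thesis unfolding zero det
  proof
    assume "det S = 0"
    then show "\<exists>u\<in>curve_coords g (?h f1 * ?h f2).
       section_value g k (?h a) (?h b) u = 0 \<and> section_value g k (?h c) (?h d) u = 0"
      unfolding S_def
      by (intro common_zero_if_det_resultant_mat_eq_0) (use assms(5,6) a b c d in simp_all)
  next
    assume "\<exists>u\<in>curve_coords g (?h f1 * ?h f2).
       section_value g k (?h a) (?h b) u = 0 \<and> section_value g k (?h c) (?h d) u = 0"
    then obtain x z y where xz: "(x, z) \<noteq> (0, 0)"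
      and y: "y\<^sup>2 = hom_eval (2 * g + 2) (?h f1 * ?h f2) x z"
      and s: "section_value g k (?h a) (?h b) (x, z, y) = 0"
        "section_value g k (?h c) (?h d) (x, z, y) = 0"
      by (auto simp: curve_coords_def)
    \<comment> \<open>For \<open>k = 0\<close> the matrix is empty and its determinant is 1. In that
      case \<open>b = d = 0\<close>, and the sections are constants \<open>a\<close> and
      \<open>c\<close>, not both zero, so they have no common zero.\<close>
    have "k > 0"
    proof (rule ccontr)
      assume "\<not> k > 0"
      then have k: "k = 0" and bd: "b = 0" "d = 0" using b d by auto
      then have "poly.coeff a 0 = 0" "poly.coeff c 0 = 0"
        using s by (simp_all add: section_value_def hom_eval_def coeff_map_poly)
      then have "a = 0" "c = 0" using a c k by (metis le_zero_eq leading_coeff_0_iff)+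
      then show False using assms(7) bd by simp
    qed
    moreover have "hom_eval (g + 1) (?h f1) x z \<noteq> 0 \<or> hom_eval (g + 1) (?h f2) x z \<noteq> 0"
      by (rule no_common_zero_of_factors) (use assms(3,5,6) fh xz in auto)
    moreover have "y\<^sup>2 = hom_eval (g + 1) (?h f1) x z * hom_eval (g + 1) (?h f2) x z"
      using hom_eval_mult[of "?h f1" "g + 1" "?h f2" "g + 1" x z] y assms(5,6)
      by (simp add: mult_2)
    ultimately show "det S = 0"
      unfolding S_def
      by (intro det_resultant_mat_eq_0_if_common_zero[where x = x and z = z and y = y and g = g])
        (use assms(5,6) a b c d xz s in simp_all)
  qed
qed

end
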